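(* Let $G$ be a finite simple graph with spectral radius $\lambda(G)$ (the largest eigenvalue of its adjacency matrix). Then \[ \lambda(G)\leq \sum_{v\in V(G)}\frac{\mathrm{cl}(v)-1}{\mathrm{cl}(v)}. \] Equality holds if and only if $G$ is, up to isolated vertices, a regular complete multi-partite graph.
   Context: $\mathrm{cl}(v)$ denotes the order of a largest clique of $G$ containing the vertex $v$ (so $\mathrm{cl}(v)=1$ for an isolated vertex). *)

theory Defs
  imports
    "Graph_Theory.Digraph_Component"
    "Jordan_Normal_Form.Spectral_Radius"
    "HOL-Library.Disjoint_Sets"
begin

text \<open>
  A finite simple graph is a digraph satisfying \<open>graph\<close>, that is, finite, without loops and
  parallel arcs, and symmetric: the edge \<open>uv\<close> is the pair of arcs from \<open>u\<close> to \<open>v\<close> and back, so that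
  adjacency is \<open>u \<rightarrow>\<^bsub>G\<^esub> v\<close> and the degree of a vertex is its out-degree.
\<close>

definition adjacency_mat :: "('a, 'b) pre_digraph \<Rightarrow> 'a list \<Rightarrow> real mat" where
  "adjacency_mat G vs =
     mat (length vs) (length vs) (\<lambda>(i, j). if vs ! i \<rightarrow>\<^bsub>G\<^esub> vs ! j then 1 else 0)"

text \<open>
  The vertices are listed in an arbitrary order; another order conjugates the adjacency matrix by a
  permutation matrix and leaves the eigenvalues unchanged. The spectrum is that of a real matrix,
  hence the set of its real eigenvalues, which are all of them because the matrix is symmetric.
  If \<open>G\<close> has no vertices, the spectrum is empty and the value is unspecified.
\<close>

definition graph_spectral_radius :: "('a, 'b) pre_digraph \<Rightarrow> real" where
  "graph_spectral_radius G =
     Max (spectrum (adjacency_mat G (SOME vs. distinct vs \<and> set vs = verts G)))"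

definition is_clique :: "('a, 'b) pre_digraph \<Rightarrow> 'a set \<Rightarrow> bool" where
  "is_clique G K \<longleftrightarrow> K \<subseteq> verts G \<and> (\<forall>u\<in>K. \<forall>v\<in>K. u \<noteq> v \<longrightarrow> u \<rightarrow>\<^bsub>G\<^esub> v)"

definition cl :: "('a, 'b) pre_digraph \<Rightarrow> 'a \<Rightarrow> nat" where
  "cl G v = Max {card K | K. is_clique G K \<and> v \<in> K}"

definition regular_graph :: "('a, 'b) pre_digraph \<Rightarrow> bool" where
  "regular_graph G \<longleftrightarrow> (\<exists>d. \<forall>v\<in>verts G. out_degree G v = d)"

text \<open>The number of parts is arbitrary; a single part gives an edgeless graph.\<close>

definition complete_multipartite :: "('a, 'b) pre_digraph \<Rightarrow> bool" where
  "complete_multipartite G \<longleftrightarrow>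
     (\<exists>P. partition_on (verts G) P \<and>
          (\<forall>u\<in>verts G. \<forall>v\<in>verts G. u \<rightarrow>\<^bsub>G\<^esub> v \<longleftrightarrow> \<not> (\<exists>p\<in>P. u \<in> p \<and> v \<in> p)))"

definition isolated :: "('a, 'b) pre_digraph \<Rightarrow> 'a \<Rightarrow> bool" where
  "isolated G v \<longleftrightarrow> v \<in> verts G \<and> (\<forall>u\<in>verts G. \<not> v \<rightarrow>\<^bsub>G\<^esub> u)"

definition up_to_isolated_vertices ::
  "(('a, 'b) pre_digraph \<Rightarrow> bool) \<Rightarrow> ('a, 'b) pre_digraph \<Rightarrow> bool" where
  "up_to_isolated_vertices Q G \<longleftrightarrow>
     (\<exists>S \<subseteq> verts G. (\<forall>v \<in> verts G - S. isolated G v) \<and> Q (G \<restriction> S))"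

end

theory Submission
  imports Defs "HOL-Analysis.Convex"
begin

text \<open>
  Write \<open>w v = (cl v - 1) / cl v\<close> and let \<open>z\<close> be an eigenvector for the eigenvalue \<open>\<lambda>\<close>. Substituting
  \<open>y v = sqrt (w v) \<bar>z v\<bar>\<close> turns the quadratic form of the adjacency matrix at \<open>\<bar>z\<bar>\<close> into that of the
  matrix with entries \<open>1 / sqrt (w u * w v)\<close> on the edges. The argument of Motzkin and Straus (shift
  mass between two nonadjacent vertices of the support until the support is a clique \<open>K\<close>, where
  \<open>cl v \<ge> card K\<close>) bounds this form by \<open>(\<Sum>v. y v)\<^sup>2\<close>, and Cauchy-Schwarz bounds that by
  \<open>(\<Sum>v. w v) (\<Sum>v. (z v)\<^sup>2)\<close>.

  In the equality case \<open>\<bar>z\<bar>\<close> is proportional to \<open>sqrt w\<close>, so \<open>y\<close> is a maximiser that is positive on all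
  non-isolated vertices; a second-order perturbation shows that nonadjacency is transitive there, an
  exchange argument on cliques that \<open>cl\<close> is constant there, and then the eigenvector is constant in
  absolute value, which forces regularity.
\<close>

section \<open>Bilinear forms of functions on a vertex set\<close>

definition bilin :: "'a set \<Rightarrow> ('a \<Rightarrow> 'a \<Rightarrow> real) \<Rightarrow> ('a \<Rightarrow> real) \<Rightarrow> ('a \<Rightarrow> real) \<Rightarrow> real" where
  "bilin V M x y = (\<Sum>u\<in>V. \<Sum>v\<in>V. M u v * x u * y v)"

lemma bilin_add_left: "bilin V M (\<lambda>i. x i + y i) z = bilin V M x z + bilin V M y z"
  by (simp add: bilin_def sum.distrib algebra_simps)

lemma bilin_add_right: "bilin V M z (\<lambda>i. x i + y i) = bilin V M z x + bilin V M z y"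
  by (simp add: bilin_def sum.distrib algebra_simps)

lemma bilin_scale_left: "bilin V M (\<lambda>i. c * x i) z = c * bilin V M x z"
  by (simp add: bilin_def sum_distrib_left algebra_simps)

lemma bilin_scale_right: "bilin V M z (\<lambda>i. c * x i) = c * bilin V M z x"
  by (simp add: bilin_def sum_distrib_left algebra_simps)

lemma bilin_commute:
  assumes "\<And>u v. u \<in> V \<Longrightarrow> v \<in> V \<Longrightarrow> M u v = M v u"
  shows "bilin V M x y = bilin V M y x"
proof -
  have "bilin V M x y = (\<Sum>v\<in>V. \<Sum>u\<in>V. M u v * x u * y v)"
    unfolding bilin_def by (rule sum.swap)
  also have "\<dots> = bilin V M y x"
    unfolding bilin_def using assms by (intro sum.cong refl) (simp add: mult.assoc mult.left_commute)
  finally show ?thesis .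
qed

text \<open>Symmetry of \<open>M\<close> merges the two mixed terms of the expansion. The directions
  \<open>d\<close> chosen later are sparse, so that the quadratic coefficient can be evaluated
  explicitly.\<close>

lemma bilin_perturb:
  assumes "\<And>u v. u \<in> V \<Longrightarrow> v \<in> V \<Longrightarrow> M u v = M v u"
  shows "bilin V M (\<lambda>i. y i + t * d i) (\<lambda>i. y i + t * d i) =
    bilin V M y y + 2 * t * bilin V M y d + t\<^sup>2 * bilin V M d d"
  using bilin_commute[of V M d y, OF assms]
  by (simp add: bilin_add_left bilin_add_right bilin_scale_left bilin_scale_right
      power2_eq_square algebra_simps)

lemma bilin_unit:
  assumes "finite V" "u \<in> V" "v \<in> V"
  shows "bilin V M (\<lambda>i. of_bool (i = u)) (\<lambda>i. of_bool (i = v)) = M u v"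
proof -
  have "M i j * of_bool (i = u) * of_bool (j = v) = (if j = v then if i = u then M i j else 0 else 0)"
    for i j by simp
  then show ?thesis using assms by (simp add: bilin_def)
qed

section \<open>A weighted Motzkin-Straus inequality\<close>

text \<open>On a clique of order \<open>k > 1\<close> in the graph of nonzero entries, each entry is
  at most \<open>k / (k - 1)\<close>, the constant off-diagonal value for which the uniform
  distribution on the clique gives the form the value 1. The product form of the bound covers
  \<open>k = 1\<close> without a division by zero.\<close>

definition clique_weighted :: "'a set \<Rightarrow> ('a \<Rightarrow> 'a \<Rightarrow> real) \<Rightarrow> bool" where
  "clique_weighted V M \<longleftrightarrow> finite V \<and> (\<forall>u\<in>V. M u u = 0) \<and> (\<forall>u\<in>V. \<forall>v\<in>V. M u v = M v u) \<and>
    (\<forall>K\<subseteq>V. (\<forall>u\<in>K. \<forall>v\<in>K. u \<noteq> v \<longrightarrow> M u v \<noteq> 0) \<longrightarrow>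
      (\<forall>u\<in>K. \<forall>v\<in>K. (real (card K) - 1) * M u v \<le> real (card K)))"

text \<open>For a support of order \<open>k > 1\<close>, the entry bound and the zero diagonal bound
  the form by \<open>k / (k - 1)\<close> times the squared total minus the sum of squares; by
  Cauchy-Schwarz that sum of squares is at least the squared total divided by
  \<open>k\<close>.\<close>

lemma bilin_clique_le:
  assumes cw: "clique_weighted V M" and y: "\<And>u. u \<in> V \<Longrightarrow> 0 \<le> y u"
    and clique: "\<And>u v. u \<in> V \<Longrightarrow> v \<in> V \<Longrightarrow> y u \<noteq> 0 \<Longrightarrow> y v \<noteq> 0 \<Longrightarrow> u \<noteq> v \<Longrightarrow> M u v \<noteq> 0"
  shows "bilin V M y y \<le> (sum y V)\<^sup>2"
proof -
  define K where "K = {v\<in>V. y v \<noteq> 0}"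
  define k where "k = real (card K)"
  have fin: "finite V" and diag: "\<And>u. u \<in> V \<Longrightarrow> M u u = 0"
    using cw by (auto simp: clique_weighted_def)
  have K: "K \<subseteq> V" "finite K" using fin by (auto simp: K_def)
  have sK: "sum y V = sum y K"
    using K fin by (intro sum.mono_neutral_right) (auto simp: K_def)
  have "\<forall>u\<in>K. \<forall>v\<in>K. u \<noteq> v \<longrightarrow> M u v \<noteq> 0" using clique by (auto simp: K_def)
  then have Mk: "(k - 1) * M u v \<le> k" if "u \<in> K" "v \<in> K" for u v
    using cw K that unfolding clique_weighted_def k_def by blast
  have bK: "bilin V M y y = (\<Sum>u\<in>K. \<Sum>v\<in>K. M u v * y u * y v)"
  proof -
    have "bilin V M y y = (\<Sum>u\<in>V. \<Sum>v\<in>K. M u v * y u * y v)"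
      unfolding bilin_def using K fin
      by (intro sum.cong refl sum.mono_neutral_right) (auto simp: K_def)
    also have "\<dots> = (\<Sum>u\<in>K. \<Sum>v\<in>K. M u v * y u * y v)"
      using K fin by (intro sum.mono_neutral_right) (auto simp: K_def)
    finally show ?thesis .
  qed
  show ?thesis
  proof (cases "card K \<le> 1")
    case True
    then have "\<And>u v. u \<in> K \<Longrightarrow> v \<in> K \<Longrightarrow> u = v" using K(2) by (metis card_le_Suc0_iff_eq One_nat_def)
    then have "M u v = 0" if "u \<in> K" "v \<in> K" for u v using that diag K by auto
    then have "bilin V M y y = 0" using bK by simp
    then show ?thesis by simp
  next
    case False
    then have k: "k > 1" by (simp add: k_def)
    have "(k - 1) * bilin V M y y = (\<Sum>u\<in>K. \<Sum>v\<in>K. (k - 1) * M u v * (y u * y v))"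
      unfolding bK by (simp add: sum_distrib_left mult.assoc)
    also have "\<dots> \<le> (\<Sum>u\<in>K. \<Sum>v\<in>K. (if u = v then 0 else k * (y u * y v)))"
    proof (intro sum_mono)
      fix u v assume uv: "u \<in> K" "v \<in> K"
      then have "0 \<le> y u * y v" using y K by (intro mult_nonneg_nonneg) auto
      then have "(k - 1) * M u v * (y u * y v) \<le> k * (y u * y v)"
        using Mk[OF uv] by (rule mult_right_mono[rotated])
      then show "(k - 1) * M u v * (y u * y v) \<le> (if u = v then 0 else k * (y u * y v))"
        using diag uv K by auto
    qed
    also have "\<dots> = (\<Sum>u\<in>K. \<Sum>v\<in>K. k * (y u * y v) - (if u = v then k * (y u)\<^sup>2 else 0))"
      by (intro sum.cong refl) (auto simp: power2_eq_square)
    also have "\<dots> = k * (sum y K)\<^sup>2 - k * (\<Sum>u\<in>K. (y u)\<^sup>2)"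
    proof -
      have "k * (sum y K)\<^sup>2 = (\<Sum>u\<in>K. \<Sum>v\<in>K. k * (y u * y v))"
        unfolding power2_eq_square sum_product by (simp only: sum_distrib_left)
      then show ?thesis using K by (simp add: sum_subtractf sum_distrib_left)
    qed
    also have "\<dots> \<le> k * (sum y K)\<^sup>2 - (sum y K)\<^sup>2"
      using sum_squared_le_sum_of_squares[of y K] K by (simp add: k_def mult.commute)
    also have "\<dots> = (k - 1) * (sum y V)\<^sup>2" by (simp add: sK algebra_simps)
    finally show ?thesis using k by simp
  qed
qed

text \<open>Induction on the size of the support: as long as two of its vertices have entry 0, mass
  can be shifted between them until one is emptied, with the total unchanged and the form not
  decreased. A support without such a pair is a clique.\<close>

theorem weighted_motzkin_straus:
  assumes cw: "clique_weighted V M" and y: "\<And>u. u \<in> V \<Longrightarrow> 0 \<le> y u"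
  shows "bilin V M y y \<le> (sum y V)\<^sup>2"
  using y
proof (induction "card {v\<in>V. y v \<noteq> 0}" arbitrary: y rule: less_induct)
  case less
  have fin: "finite V" and diag: "\<And>u. u \<in> V \<Longrightarrow> M u u = 0"
    and sym: "\<And>u v. u \<in> V \<Longrightarrow> v \<in> V \<Longrightarrow> M u v = M v u"
    using cw by (auto simp: clique_weighted_def)
  show ?case
  proof (cases "\<forall>u\<in>V. \<forall>v\<in>V. y u \<noteq> 0 \<longrightarrow> y v \<noteq> 0 \<longrightarrow> u \<noteq> v \<longrightarrow> M u v \<noteq> 0")
    case True
    then show ?thesis by (intro bilin_clique_le[OF cw]) (auto simp: less.prems)
  next
    case False
    then obtain u v where uv: "u \<in> V" "v \<in> V" "y u \<noteq> 0" "y v \<noteq> 0" "u \<noteq> v" "M u v = 0" by blast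
    define d :: "'a \<Rightarrow> real" where "d = (\<lambda>i. of_bool (i = u) + (-1) * of_bool (i = v))"
    \<comment> \<open>the form is affine along \<open>d\<close>, so moving to one of the two ends does not decrease it\<close>
    have dd: "bilin V M d d = 0"
      using uv diag sym[of u v] fin unfolding d_def
      by (simp only: bilin_add_left bilin_add_right bilin_scale_left bilin_scale_right) (simp add: bilin_unit)
    have sd: "sum d V = 0" using uv fin by (simp add: d_def sum_subtractf of_bool_def)
    \<comment> \<open>The sign makes the linear term nonnegative, and the size makes one mass
      exactly 0: \<open>t = y v\<close> empties \<open>v\<close>, while \<open>t = - y u\<close>
      empties \<open>u\<close>.\<close>
    define t where "t = (if bilin V M y d \<ge> 0 then y v else - y u)"
    define y' where "y' = (\<lambda>i. y i + t * d i)"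
    have pos: "0 < y u" "0 < y v" using less.prems uv by (auto simp: less_le)
    have t: "0 \<le> t * bilin V M y d" unfolding t_def using pos by (auto intro: mult_nonneg_nonneg mult_nonneg_nonpos)
    have y'0: "0 \<le> y' i" if "i \<in> V" for i
      using pos less.prems that uv(5) by (auto simp: y'_def d_def t_def)
    have "bilin V M y y \<le> bilin V M y' y'"
      unfolding y'_def using bilin_perturb[OF sym, where y=y and t=t and d=d] t dd by simp
    also have "\<dots> \<le> (sum y' V)\<^sup>2"
    proof (rule less.hyps)
      obtain j where j: "j \<in> V" "y j \<noteq> 0" "y' j = 0"
      proof (cases "bilin V M y d \<ge> 0")
        case True
        then have "y' v = 0" using uv by (simp add: y'_def t_def) (simp add: d_def)
        then show ?thesis using that uv by blast
      next
        case False
        then have "y' u = 0" using uv by (simp add: y'_def t_def) (simp add: d_def)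
        then show ?thesis using that uv by blast
      qed
      have "d i = 0" if "y i = 0" for i using uv that by (auto simp: d_def)
      then have "{i\<in>V. y' i \<noteq> 0} \<subseteq> {i\<in>V. y i \<noteq> 0} - {j}"
        using j by (auto simp: y'_def)
      also have "\<dots> \<subset> {i\<in>V. y i \<noteq> 0}" using j by auto
      finally show "card {i\<in>V. y' i \<noteq> 0} < card {i\<in>V. y i \<noteq> 0}"
        using fin by (intro psubset_card_mono) auto
    qed (use y'0 in auto)
    also have "sum y' V = sum y V"
      using sd by (simp add: y'_def sum.distrib sum_distrib_left[symmetric])
    finally show ?thesis .
  qed
qed

text \<open>
  At a maximiser the form cannot be strictly convex along the mass-preserving direction
  \<open>e\<^sub>u + e\<^sub>w - 2 e\<^sub>v\<close>, on which it takes the value \<open>2 M u w\<close>.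
\<close>

lemma motzkin_straus_equality_trans:
  assumes cw: "clique_weighted V M" and y: "\<And>u. u \<in> V \<Longrightarrow> 0 \<le> y u"
    and eq: "bilin V M y y = (sum y V)\<^sup>2"
    and V: "u \<in> V" "v \<in> V" "w \<in> V" and pos: "0 < y u" "0 < y v" "0 < y w"
    and zero: "M u v = 0" "M v w = 0"
  shows "M u w \<le> 0"
proof -
  have fin: "finite V" and diag: "\<And>u. u \<in> V \<Longrightarrow> M u u = 0"
    and sym: "\<And>u v. u \<in> V \<Longrightarrow> v \<in> V \<Longrightarrow> M u v = M v u"
    using cw by (auto simp: clique_weighted_def)
  define d :: "'a \<Rightarrow> real" where "d = (\<lambda>i. of_bool (i = u) + (of_bool (i = w) + (-2) * of_bool (i = v)))"
  have dd: "bilin V M d d = 2 * M u w"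
    using V diag sym[of u v] sym[of v w] sym[of u w] zero fin unfolding d_def
    by (simp only: bilin_add_left bilin_add_right bilin_scale_left bilin_scale_right) (simp add: bilin_unit)
  have sd: "sum d V = 0" using V fin by (simp add: d_def sum.distrib sum_subtractf of_bool_def sum_negf sum_distrib_left[symmetric])
  \<comment> \<open>Every value of \<open>d\<close> has absolute value at most 2, even if some of
    \<open>u\<close>, \<open>v\<close>, \<open>w\<close> coincide, so half of the smallest mass
    keeps \<open>y\<close> nonnegative for both signs of the shift.\<close>
  define t where "t = min (y u) (min (y v) (y w)) / 2"
  have t: "t > 0" using pos by (simp add: t_def)
  have le: "bilin V M y y + 2 * s * bilin V M y d + s\<^sup>2 * bilin V M d d \<le> bilin V M y y" if "\<bar>s\<bar> = t" for s
  proof -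
    have st: "2 * \<bar>s\<bar> \<le> y u" "2 * \<bar>s\<bar> \<le> y v" "2 * \<bar>s\<bar> \<le> y w" using that by (auto simp: t_def)
    have "bilin V M (\<lambda>i. y i + s * d i) (\<lambda>i. y i + s * d i) \<le> (\<Sum>i\<in>V. y i + s * d i)\<^sup>2"
    proof (rule weighted_motzkin_straus[OF cw])
      fix i assume "i \<in> V"
      then show "0 \<le> y i + s * d i" using y[of i] st by (auto simp: d_def)
    qed
    also have "(\<Sum>i\<in>V. y i + s * d i) = sum y V"
      using sd by (simp add: sum.distrib sum_distrib_left[symmetric])
    finally show ?thesis using eq bilin_perturb[OF sym, where y=y and t=s and d=d] by simp
  qed
  \<comment> \<open>The linear terms of the two opposite shifts cancel on adding, which leaves the
    quadratic term alone.\<close>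
  from le[of t] le[of "-t"] t have "t\<^sup>2 * bilin V M d d \<le> 0" by simp
  then show ?thesis using t dd by (simp add: mult_le_0_iff)
qed

section \<open>Degrees as row sums of the adjacency matrix\<close>

text \<open>In the absence of parallel arcs, an arc leaving \<open>u\<close> is determined by its
  head, so counting arcs is counting neighbours.\<close>

lemma (in digraph) out_degree_eq_sum:
  "real (out_degree G u) = (\<Sum>v\<in>verts G. of_bool (u \<rightarrow>\<^bsub>G\<^esub> v))"
proof -
  have "bij_betw (head G) (out_arcs G u) {v\<in>verts G. u \<rightarrow>\<^bsub>G\<^esub> v}"
  proof (rule bij_betw_imageI)
    show "inj_on (head G) (out_arcs G u)"
      by (rule inj_onI) (auto intro: no_multi_arcs simp: arc_to_ends_def)
    show "head G ` out_arcs G u = {v\<in>verts G. u \<rightarrow>\<^bsub>G\<^esub> v}"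
      by (auto simp: arcs_ends_conv)
  qed
  then have "out_degree G u = card {v\<in>verts G. u \<rightarrow>\<^bsub>G\<^esub> v}"
    unfolding out_degree_def by (rule bij_betw_same_card)
  then show ?thesis by (simp add: of_bool_def sum.If_cases Int_def)
qed

lemma dominates_induce_subgraph_iff:
  "u \<rightarrow>\<^bsub>G \<restriction> S\<^esub> v \<longleftrightarrow> u \<in> S \<and> v \<in> S \<and> u \<rightarrow>\<^bsub>G\<^esub> v"
  by (auto simp: arcs_ends_conv)

lemma (in digraph) out_degree_induce_subgraph:
  assumes "S \<subseteq> verts G" "u \<in> S"
  shows "real (out_degree (G \<restriction> S) u) = (\<Sum>v\<in>S. of_bool (u \<rightarrow>\<^bsub>G\<^esub> v))"
proof -
  interpret H: digraph "G \<restriction> S" using assms by (intro digraphI_induced induced_induce)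
  show ?thesis using assms by (simp add: H.out_degree_eq_sum dominates_induce_subgraph_iff)
qed

section \<open>Eigenvectors as functions on the vertex set\<close>

text \<open>Transport along the enumeration \<open>vs\<close> turns vectors into functions on
  \<open>V\<close>, so that the order of the vertices disappears. The field is kept general because
  both complex and real matrices occur below.\<close>

lemma eigenvalue_mat_iff:
  fixes A :: "'a \<Rightarrow> 'a \<Rightarrow> 'k :: field"
  assumes vs: "distinct vs" "set vs = V"
  shows "eigenvalue (mat (length vs) (length vs) (\<lambda>(i, j). A (vs ! i) (vs ! j))) k \<longleftrightarrow>
    (\<exists>z. (\<exists>v\<in>V. z v \<noteq> 0) \<and> (\<forall>u\<in>V. (\<Sum>v\<in>V. A u v * z v) = k * z u))"
proof -
  define n where "n = length vs"
  define B where "B = mat n n (\<lambda>(i, j). A (vs ! i) (vs ! j))"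
  have bij: "bij_betw ((!) vs) {..<n} V" using vs by (auto intro: bij_betw_nth simp: n_def)
  have sum_V: "sum g V = (\<Sum>i<n. g (vs ! i))" for g :: "'a \<Rightarrow> 'k"
    by (rule sum.reindex_bij_betw[OF bij, symmetric])
  have ball_V: "(\<forall>v\<in>V. P v) \<longleftrightarrow> (\<forall>i<n. P (vs ! i))" for P
    using bij by (auto simp: bij_betw_def)
  have Bx: "B *\<^sub>v x = k \<cdot>\<^sub>v x \<longleftrightarrow> (\<forall>i<n. (\<Sum>j<n. A (vs ! i) (vs ! j) * x $ j) = k * x $ i)"
    if "x \<in> carrier_vec n" for x
    using that by (auto simp: B_def vec_eq_iff scalar_prod_def atLeast0LessThan)
  have "eigenvalue B k \<longleftrightarrow> (\<exists>x. x \<in> carrier_vec n \<and> \<not> (\<forall>i<n. x $ i = 0) \<and>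
      (\<forall>i<n. (\<Sum>j<n. A (vs ! i) (vs ! j) * x $ j) = k * x $ i))"
  proof -
    have dim: "dim_row B = n" by (simp add: B_def)
    have zero: "x = 0\<^sub>v n \<longleftrightarrow> (\<forall>i<n. x $ i = 0)" if "x \<in> carrier_vec n" for x
      using that by (auto simp: vec_eq_iff)
    show ?thesis
      unfolding eigenvalue_def eigenvector_def dim
      by (intro ex_cong1 conj_cong refl) (simp_all only: zero Bx)
  qed
  also have "\<dots> \<longleftrightarrow> (\<exists>z. \<not> (\<forall>v\<in>V. z v = 0) \<and> (\<forall>u\<in>V. (\<Sum>v\<in>V. A u v * z v) = k * z u))"
    (is "?L \<longleftrightarrow> ?R")
  proof
    assume ?L
    then obtain x where x: "x \<in> carrier_vec n" "\<not> (\<forall>i<n. x $ i = 0)"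
      "\<forall>i<n. (\<Sum>j<n. A (vs ! i) (vs ! j) * x $ j) = k * x $ i" by blast
    define z where "z = (\<lambda>v. x $ inv_into {..<n} ((!) vs) v)"
    have "z (vs ! i) = x $ i" if "i < n" for i
      using bij that by (simp add: z_def bij_betw_def inv_into_f_f)
    with x show ?R by (intro exI[of _ z]) (simp add: sum_V ball_V)
  next
    assume ?R
    then obtain z where "\<not> (\<forall>v\<in>V. z v = 0)" "\<forall>u\<in>V. (\<Sum>v\<in>V. A u v * z v) = k * z u" by blast
    then show ?L by (intro exI[of _ "vec n (\<lambda>i. z (vs ! i))"]) (simp add: sum_V ball_V)
  qed
  finally show ?thesis by (simp add: B_def n_def)
qed

text \<open>A complex eigenvalue exists, the Hermitian form of the eigenvector shows that it is
  real, and then the real or the imaginary part of the eigenvector serves. This is what makes the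
  real spectrum nonempty.\<close>

lemma real_symmetric_has_eigenvector:
  fixes A :: "'a \<Rightarrow> 'a \<Rightarrow> real"
  assumes V: "finite V" "V \<noteq> {}" and sym: "\<And>u v. u \<in> V \<Longrightarrow> v \<in> V \<Longrightarrow> A u v = A v u"
  shows "\<exists>k z. (\<exists>v\<in>V. z v \<noteq> 0) \<and> (\<forall>u\<in>V. (\<Sum>v\<in>V. A u v * z v) = k * z u)"
proof -
  obtain vs where vs: "distinct vs" "set vs = V" using finite_distinct_list[OF V(1)] by blast
  define B where "B = mat (length vs) (length vs) (\<lambda>(i, j). complex_of_real (A (vs ! i) (vs ! j)))"
  have "length vs > 0" using vs V by auto
  then have "spectrum B \<noteq> {}" by (intro spectrum_non_empty) (auto simp: B_def)
  then obtain c where "eigenvalue B c" by (auto simp: spectrum_def)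
  then obtain z where z: "\<exists>v\<in>V. z v \<noteq> 0"
    and eig: "\<And>u. u \<in> V \<Longrightarrow> (\<Sum>v\<in>V. complex_of_real (A u v) * z v) = c * z u"
    unfolding B_def eigenvalue_mat_iff[OF vs, of "\<lambda>u v. complex_of_real (A u v)"] by blast
  define q where "q = (\<Sum>u\<in>V. \<Sum>v\<in>V. complex_of_real (A u v) * cnj (z u) * z v)"
  define N where "N = (\<Sum>u\<in>V. (cmod (z u))\<^sup>2)"
  have "q = (\<Sum>u\<in>V. cnj (z u) * (\<Sum>v\<in>V. complex_of_real (A u v) * z v))"
    unfolding q_def by (simp add: sum_distrib_left mult_ac)
  also have "\<dots> = (\<Sum>u\<in>V. cnj (z u) * (c * z u))" by (simp only: eig cong: sum.cong)
  also have "\<dots> = c * N"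
    unfolding N_def of_real_sum complex_norm_square by (simp add: sum_distrib_left mult_ac)
  finally have q: "q = c * N" .
  \<comment> \<open>Conjugation amounts to exchanging the summation indices, hence \<open>q\<close>
    is real by symmetry of \<open>A\<close>.\<close>
  have "cnj q = (\<Sum>v\<in>V. \<Sum>u\<in>V. complex_of_real (A u v) * cnj (z v) * z u)"
    unfolding q_def by (subst sum.swap) (simp add: mult_ac)
  also have "\<dots> = q" unfolding q_def using sym by (intro sum.cong refl) auto
  finally have "cnj c * N = c * N" by (simp add: q)
  moreover have "N > 0"
    unfolding N_def using z V by (metis sum_pos2 zero_le_power2 zero_less_norm_iff zero_less_power)
  ultimately have "cnj c = c" by simp
  then have c: "c = of_real (Re c)" by (simp add: complex_eq_iff)
  have re: "(\<Sum>v\<in>V. A u v * Re (z v)) = Re c * Re (z u)" if "u \<in> V" for u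
    using arg_cong[OF eig[OF that], of Re] by (subst (asm) c) simp
  have im: "(\<Sum>v\<in>V. A u v * Im (z v)) = Re c * Im (z u)" if "u \<in> V" for u
    using arg_cong[OF eig[OF that], of Im] by (subst (asm) c) simp
  \<comment> \<open>Both parts of \<open>z\<close> satisfy the real eigenvalue equation, and at
    least one of them is nonzero.\<close>
  show ?thesis
  proof (cases "\<exists>v\<in>V. Re (z v) \<noteq> 0")
    case True
    then show ?thesis
      using re by (intro exI[of _ "Re c"] exI[of _ "\<lambda>v. Re (z v)"]) simp
  next
    case False
    then have "\<exists>v\<in>V. Im (z v) \<noteq> 0" using z by (auto simp: complex_eq_iff)
    then show ?thesis
      using im by (intro exI[of _ "Re c"] exI[of _ "\<lambda>v. Im (z v)"]) simp
  qed
qed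

abbreviation adj :: "('a, 'b) pre_digraph \<Rightarrow> 'a \<Rightarrow> 'a \<Rightarrow> real" where
  "adj G u v \<equiv> of_bool (u \<rightarrow>\<^bsub>G\<^esub> v)"

definition adjacency_eigenpair :: "('a, 'b) pre_digraph \<Rightarrow> real \<Rightarrow> ('a \<Rightarrow> real) \<Rightarrow> bool" where
  "adjacency_eigenpair G k z \<longleftrightarrow> (\<exists>v\<in>verts G. z v \<noteq> 0) \<and>
    (\<forall>u\<in>verts G. (\<Sum>v\<in>verts G. adj G u v * z v) = k * z u)"

text \<open>The real spectrum is finite and, by symmetry of adjacency, nonempty, so its maximum is
  attained. From here on the spectral radius is accessed only through eigenfunctions on the
  vertices.\<close>

lemma (in graph) graph_spectral_radius_eigen:
  assumes "verts G \<noteq> {}"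
  shows "\<exists>z. adjacency_eigenpair G (graph_spectral_radius G) z"
    and "adjacency_eigenpair G k z \<Longrightarrow> k \<le> graph_spectral_radius G"
proof -
  define vs where "vs = (SOME vs. distinct vs \<and> set vs = verts G)"
  have vs: "distinct vs" "set vs = verts G"
    using someI_ex[of "\<lambda>vs. distinct vs \<and> set vs = verts G"] finite_distinct_list[OF finite_verts]
    by (auto simp: vs_def)
  define A where "A = adjacency_mat G vs"
  have A: "A = mat (length vs) (length vs) (\<lambda>(i, j). of_bool (vs ! i \<rightarrow>\<^bsub>G\<^esub> vs ! j))"
    by (simp add: A_def adjacency_mat_def of_bool_def)
  have spec: "k \<in> spectrum A \<longleftrightarrow> (\<exists>z. adjacency_eigenpair G k z)" for k
    unfolding spectrum_def A adjacency_eigenpair_def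
    using eigenvalue_mat_iff[OF vs, of "\<lambda>u v. of_bool (u \<rightarrow>\<^bsub>G\<^esub> v)" k] by simp
  have fin: "finite (spectrum A)" by (rule card_finite_spectrum[of _ "length vs"]) (simp add: A)
  have rad: "graph_spectral_radius G = Max (spectrum A)"
    by (simp add: graph_spectral_radius_def A_def vs_def)
  have "\<exists>k z. adjacency_eigenpair G k z"
    unfolding adjacency_eigenpair_def
    by (rule real_symmetric_has_eigenvector[OF finite_verts assms]) (rule arg_cong[where f = of_bool], metis graph_symmetric)
  then obtain k where "\<exists>z. adjacency_eigenpair G k z" by (rule exE)
  then have "k \<in> spectrum A" unfolding spec .
  then have "Max (spectrum A) \<in> spectrum A" by (intro Max_in[OF fin]) auto
  then show "\<exists>z. adjacency_eigenpair G (graph_spectral_radius G) z"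
    unfolding rad spec .
  show "k \<le> graph_spectral_radius G" if "adjacency_eigenpair G k z" for k z
  proof -
    have "k \<in> spectrum A" using that spec by auto
    then show ?thesis unfolding rad by (rule Max_ge[OF fin])
  qed
qed

section \<open>Largest cliques through a vertex\<close>

lemma (in fin_digraph) card_le_cl:
  assumes "is_clique G K" "v \<in> K"
  shows "card K \<le> cl G v"
proof -
  have "finite {K. is_clique G K \<and> v \<in> K}"
    by (rule finite_subset[of _ "Pow (verts G)"]) (auto simp: is_clique_def)
  then show ?thesis using assms unfolding cl_def by (intro Max_ge) (auto simp: setcompr_eq_image)
qed

text \<open>The singleton \<open>{v}\<close> is a clique, so \<open>Max\<close> is taken over a
  nonempty finite set and is a member of it.\<close>

lemma (in fin_digraph) cl_attained:
  assumes "v \<in> verts G"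
  obtains K where "is_clique G K" "v \<in> K" "card K = cl G v"
proof -
  have "finite {K. is_clique G K \<and> v \<in> K}"
    by (rule finite_subset[of _ "Pow (verts G)"]) (auto simp: is_clique_def)
  moreover have "is_clique G {v}" using assms by (auto simp: is_clique_def)
  ultimately have "cl G v \<in> {card K | K. is_clique G K \<and> v \<in> K}"
    unfolding cl_def by (intro Max_in) (auto simp: setcompr_eq_image)
  then show thesis using that by auto
qed

section \<open>Clique weights and the rescaled adjacency form\<close>

definition clique_weight :: "('a, 'b) pre_digraph \<Rightarrow> 'a \<Rightarrow> real" where
  "clique_weight G v = (real (cl G v) - 1) / real (cl G v)"

lemma (in fin_digraph) cl_pos:
  assumes "v \<in> verts G" shows "1 \<le> cl G v"
  using card_le_cl[of "{v}" v] assms by (simp add: is_clique_def)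

lemma (in fin_digraph) clique_weight_nonneg:
  assumes "v \<in> verts G" shows "0 \<le> clique_weight G v"
  using cl_pos[OF assms] by (simp add: clique_weight_def)

lemma clique_weight_mono:
  assumes "1 \<le> k" "k \<le> cl G v"
  shows "(real k - 1) / real k \<le> clique_weight G v"
  using assms by (simp add: clique_weight_def divide_simps) (simp add: algebra_simps)

lemma (in graph) cl_ge_2_iff:
  assumes "v \<in> verts G"
  shows "2 \<le> cl G v \<longleftrightarrow> (\<exists>u. v \<rightarrow>\<^bsub>G\<^esub> u)"
proof
  assume "\<exists>u. v \<rightarrow>\<^bsub>G\<^esub> u"
  then obtain u where u: "v \<rightarrow>\<^bsub>G\<^esub> u" by blast
  then have "v \<rightarrow>\<^bsub>G\<^esub> u" "u \<rightarrow>\<^bsub>G\<^esub> v" "u \<noteq> v" "u \<in> verts G"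
    using graph_symmetric[OF u] adj_not_same[of u] by (auto simp: arcs_ends_conv)
  then have "is_clique G {u, v}" "u \<noteq> v"
    using assms by (simp_all add: is_clique_def)
  then show "2 \<le> cl G v" using card_le_cl[of "{u, v}" v] by simp
next
  assume "2 \<le> cl G v"
  obtain K where K: "is_clique G K" "v \<in> K" "card K = cl G v" using cl_attained[OF assms] .
  then obtain u where "u \<in> K" "u \<noteq> v"
    using \<open>2 \<le> cl G v\<close> card_mono[of "{v}" K] by fastforce
  then have "v \<rightarrow>\<^bsub>G\<^esub> u" using K by (auto simp: is_clique_def)
  then show "\<exists>u. v \<rightarrow>\<^bsub>G\<^esub> u" by (rule exI)
qed

text \<open>The weight vanishes exactly when \<open>cl\<close> is 1, that is, at isolated vertices;
  hence division by weights is harmless at both ends of an edge.\<close>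

lemma (in graph) clique_weight_pos_iff:
  assumes "v \<in> verts G"
  shows "0 < clique_weight G v \<longleftrightarrow> (\<exists>u. v \<rightarrow>\<^bsub>G\<^esub> u)"
  using cl_ge_2_iff[OF assms] cl_pos[OF assms] by (auto simp: clique_weight_def zero_less_divide_iff)

text \<open>At an isolated vertex the denominator vanishes and the quotient is \<open>0\<close>, as it should be.\<close>

definition scaled_adj :: "('a, 'b) pre_digraph \<Rightarrow> 'a \<Rightarrow> 'a \<Rightarrow> real" where
  "scaled_adj G u v = adj G u v / (sqrt (clique_weight G u) * sqrt (clique_weight G v))"

lemma (in graph) adj_weights_pos:
  assumes "u \<rightarrow>\<^bsub>G\<^esub> v"
  shows "0 < clique_weight G u" "0 < clique_weight G v"
proof -
  have "v \<rightarrow>\<^bsub>G\<^esub> u" using assms by (rule graph_symmetric)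
  moreover have "u \<in> verts G" "v \<in> verts G" using assms by (auto simp: arcs_ends_conv)
  ultimately show "0 < clique_weight G u" "0 < clique_weight G v"
    using assms clique_weight_pos_iff by metis+
qed

text \<open>A vertex of a clique of order \<open>k\<close> has \<open>cl\<close> at least
  \<open>k\<close>, hence weight at least \<open>(k - 1) / k\<close>; for two such vertices the
  product of the square roots is at least this number, which bounds the entry by
  \<open>k / (k - 1)\<close>.\<close>

lemma (in graph) clique_weighted_scaled_adj: "clique_weighted (verts G) (scaled_adj G)"
  unfolding clique_weighted_def
proof (intro conjI ballI allI impI)
  show "finite (verts G)" by simp
next
  fix u
  show "scaled_adj G u u = 0" using adj_not_same[of u] by (auto simp: scaled_adj_def)
next
  fix u v
  show "scaled_adj G u v = scaled_adj G v u"
    using graph_symmetric[of u v] graph_symmetric[of v u] by (auto simp: scaled_adj_def mult.commute)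
next
  fix K u v
  assume K: "K \<subseteq> verts G" "\<forall>u\<in>K. \<forall>v\<in>K. u \<noteq> v \<longrightarrow> scaled_adj G u v \<noteq> 0"
    and uv: "u \<in> K" "v \<in> K"
  have clique: "is_clique G K"
    using K by (auto simp: is_clique_def scaled_adj_def split: if_splits)
  define k where "k = card K"
  have fin: "finite K" using K(1) by (rule finite_subset) simp
  show "(real (card K) - 1) * scaled_adj G u v \<le> real (card K)"
  proof (cases "u = v")
    case True
    then show ?thesis using adj_not_same[of u] by (auto simp: scaled_adj_def)
  next
    case False
    then have k: "2 \<le> k" using card_mono[OF fin, of "{u, v}"] uv by (simp add: k_def)
    define a where "a = (real k - 1) / real k"
    have a: "0 < a" using k by (simp add: a_def)
    have "a \<le> clique_weight G x" if "x \<in> K" for x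
      unfolding a_def using k card_le_cl[OF clique that] by (intro clique_weight_mono) (auto simp: k_def)
    then have "sqrt a * sqrt a \<le> sqrt (clique_weight G u) * sqrt (clique_weight G v)"
      using uv K(1) a clique_weight_nonneg by (intro mult_mono) auto
    then have "scaled_adj G u v \<le> 1 / a"
      using a unfolding scaled_adj_def by (intro frac_le) auto
    then have "(real k - 1) * scaled_adj G u v \<le> (real k - 1) * (1 / a)"
      using k by (intro mult_left_mono) auto
    also have "\<dots> = real k" using k by (simp add: a_def)
    finally show ?thesis by (simp add: k_def)
  qed
qed

text \<open>On an edge both weights are positive and the square roots cancel; a pair without an edge
  contributes 0 to both sides.\<close>

lemma (in graph) bilin_adj_eq_scaled:
  "bilin (verts G) (adj G) a a = bilin (verts G) (scaled_adj G)
    (\<lambda>v. sqrt (clique_weight G v) * a v) (\<lambda>v. sqrt (clique_weight G v) * a v)"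
  unfolding bilin_def
proof (intro sum.cong refl)
  fix u v
  show "adj G u v * a u * a v = scaled_adj G u v * (sqrt (clique_weight G u) * a u) *
      (sqrt (clique_weight G v) * a v)"
    using adj_weights_pos[of u v] by (cases "u \<rightarrow>\<^bsub>G\<^esub> v") (simp_all add: scaled_adj_def)
qed

lemma (in graph) bilin_adj_le:
  assumes "\<And>v. v \<in> verts G \<Longrightarrow> 0 \<le> a v"
  shows "bilin (verts G) (adj G) a a \<le> (\<Sum>v\<in>verts G. sqrt (clique_weight G v) * a v)\<^sup>2"
  unfolding bilin_adj_eq_scaled
  using assms clique_weight_nonneg by (intro weighted_motzkin_straus clique_weighted_scaled_adj) auto

lemma (in graph) clique_weight_Cauchy_Schwarz:
  "(\<Sum>v\<in>verts G. sqrt (clique_weight G v) * a v)\<^sup>2 \<le>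
    (\<Sum>v\<in>verts G. clique_weight G v) * (\<Sum>v\<in>verts G. (a v)\<^sup>2)"
proof -
  have "(\<Sum>v\<in>verts G. (sqrt (clique_weight G v))\<^sup>2) = (\<Sum>v\<in>verts G. clique_weight G v)"
    using clique_weight_nonneg by (intro sum.cong) auto
  then show ?thesis
    using Cauchy_Schwarz_ineq_sum[of "\<lambda>v. sqrt (clique_weight G v)" a "verts G"] by simp
qed

section \<open>The upper bound for eigenvalues\<close>

text \<open>Triangle inequality in one row of the eigenvalue equation. It allows passing to the
  absolute values of \<open>z\<close>, since the Motzkin-Straus bound concerns nonnegative
  functions.\<close>

lemma adjacency_eigenpair_abs_le:
  assumes "adjacency_eigenpair G k z" "u \<in> verts G"
  shows "k * \<bar>z u\<bar> \<le> (\<Sum>v\<in>verts G. adj G u v * \<bar>z v\<bar>)"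
proof -
  have "k * \<bar>z u\<bar> \<le> \<bar>k * z u\<bar>" by (simp add: abs_mult mult_right_mono)
  also have "k * z u = (\<Sum>v\<in>verts G. adj G u v * z v)"
    using assms by (simp add: adjacency_eigenpair_def)
  also have "\<bar>\<dots>\<bar> \<le> (\<Sum>v\<in>verts G. \<bar>adj G u v * z v\<bar>)" by (rule sum_abs)
  finally show ?thesis by (simp add: abs_mult)
qed

lemma bilin_eq_sum_mult:
  "bilin V M x y = (\<Sum>u\<in>V. x u * (\<Sum>v\<in>V. M u v * y v))"
  by (simp add: bilin_def sum_distrib_left mult_ac)

lemma adjacency_eigenpair_le_bilin:
  assumes "adjacency_eigenpair G k z"
  shows "k * (\<Sum>v\<in>verts G. \<bar>z v\<bar>\<^sup>2) \<le> bilin (verts G) (adj G) (\<lambda>v. \<bar>z v\<bar>) (\<lambda>v. \<bar>z v\<bar>)"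
proof -
  have "k * (\<Sum>v\<in>verts G. \<bar>z v\<bar>\<^sup>2) = (\<Sum>u\<in>verts G. \<bar>z u\<bar> * (k * \<bar>z u\<bar>))"
    unfolding sum_distrib_left power2_eq_square by (simp only: mult_ac)
  also have "\<dots> \<le> bilin (verts G) (adj G) (\<lambda>v. \<bar>z v\<bar>) (\<lambda>v. \<bar>z v\<bar>)"
    unfolding bilin_eq_sum_mult
    by (intro sum_mono mult_left_mono adjacency_eigenpair_abs_le[OF assms]) auto
  finally show ?thesis .
qed

lemma (in fin_digraph) adjacency_eigenpair_norm_pos:
  assumes "adjacency_eigenpair G k z"
  shows "0 < (\<Sum>v\<in>verts G. \<bar>z v\<bar>\<^sup>2)"
proof -
  obtain v where "v \<in> verts G" "z v \<noteq> 0" using assms by (auto simp: adjacency_eigenpair_def)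
  then show ?thesis by (intro sum_pos2[of _ v]) auto
qed

text \<open>The squared norm times \<open>k\<close> is at most the adjacency form at the absolute
  values, which Motzkin-Straus and Cauchy-Schwarz bound by the weight sum times the same norm; the
  norm is positive and cancels.\<close>

lemma (in graph) adjacency_eigenpair_le_weight:
  assumes "adjacency_eigenpair G k z"
  shows "k \<le> (\<Sum>v\<in>verts G. clique_weight G v)"
proof -
  have "k * (\<Sum>v\<in>verts G. \<bar>z v\<bar>\<^sup>2) \<le> (\<Sum>v\<in>verts G. clique_weight G v) * (\<Sum>v\<in>verts G. \<bar>z v\<bar>\<^sup>2)"
    using adjacency_eigenpair_le_bilin[OF assms] bilin_adj_le[of "\<lambda>v. \<bar>z v\<bar>"]
      clique_weight_Cauchy_Schwarz[of "\<lambda>v. \<bar>z v\<bar>"] by simp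
  then show ?thesis using adjacency_eigenpair_norm_pos[OF assms] by simp
qed

section \<open>Structure of the graph in the equality case\<close>

text \<open>
  A largest clique through \<open>v\<close> becomes one through \<open>u\<close> by exchanging its only possible vertex
  nonadjacent to \<open>u\<close> for \<open>u\<close>.
\<close>

lemma (in graph) cl_eq_of_nonadjacency_trans:
  assumes S: "S = {v\<in>verts G. 2 \<le> cl G v}"
    and trans: "\<And>u v w. u \<in> S \<Longrightarrow> v \<in> S \<Longrightarrow> w \<in> S \<Longrightarrow>
      \<not> u \<rightarrow>\<^bsub>G\<^esub> v \<Longrightarrow> \<not> v \<rightarrow>\<^bsub>G\<^esub> w \<Longrightarrow> \<not> u \<rightarrow>\<^bsub>G\<^esub> w"
    and uv: "u \<in> S" "v \<in> S"
  shows "cl G u = cl G v"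
proof -
  have "cl G v \<le> cl G u" if u: "u \<in> S" and v: "v \<in> S" for u v
  proof -
    have uV: "u \<in> verts G" and vV: "v \<in> verts G" using u v S by auto
    obtain K where K: "is_clique G K" "v \<in> K" "card K = cl G v" using cl_attained[OF vV] .
    have KV: "K \<subseteq> verts G" using K(1) by (simp add: is_clique_def)
    then have fin: "finite K" by (rule finite_subset) simp
    have adjK: "x \<rightarrow>\<^bsub>G\<^esub> y" if "x \<in> K" "y \<in> K" "x \<noteq> y" for x y
      using K(1) that by (simp add: is_clique_def)
    \<comment> \<open>All members of \<open>K\<close> share the clique \<open>K\<close> of order at
      least 2, so \<open>trans\<close> applies to them.\<close>
    have KS: "x \<in> S" if "x \<in> K" for x
      using card_le_cl[OF K(1) that] K(3) v KV that by (auto simp: S)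
    have extend: "is_clique G (insert u L)" if "L \<subseteq> K" "\<And>x. x \<in> L \<Longrightarrow> u \<rightarrow>\<^bsub>G\<^esub> x" for L
      unfolding is_clique_def
    proof (intro conjI ballI impI)
      show "insert u L \<subseteq> verts G" using that KV uV by auto
    next
      fix x y assume "x \<in> insert u L" "y \<in> insert u L" "x \<noteq> y"
      then consider "x = u" "y \<in> L" | "y = u" "x \<in> L" | "x \<in> L" "y \<in> L" by auto
      then show "x \<rightarrow>\<^bsub>G\<^esub> y"
        using that adjK[of x y] graph_symmetric[of y x] \<open>x \<noteq> y\<close> by cases auto
    qed
    show ?thesis
    proof (cases "u \<in> K")
      case True
      then show ?thesis using card_le_cl[OF K(1)] K(3) by simp
    next
      case u_notin: False
      show ?thesis
      proof (cases "\<forall>x\<in>K. u \<rightarrow>\<^bsub>G\<^esub> x")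
        case True
        then have "card (insert u K) \<le> cl G u" by (intro card_le_cl extend) auto
        then show ?thesis using K(3) fin u_notin by simp
      next
        case False
        then obtain x where x: "x \<in> K" "\<not> u \<rightarrow>\<^bsub>G\<^esub> x" by auto
        \<comment> \<open>A second nonneighbour \<open>y\<close> of \<open>u\<close> would be
          nonadjacent to \<open>x\<close> by transitivity through \<open>u\<close>, although both
          lie in the clique \<open>K\<close>.\<close>
        have "u \<rightarrow>\<^bsub>G\<^esub> y" if y: "y \<in> K - {x}" for y
        proof (rule ccontr)
          assume "\<not> u \<rightarrow>\<^bsub>G\<^esub> y"
          moreover have "\<not> x \<rightarrow>\<^bsub>G\<^esub> u" using x(2) graph_symmetric[of x u] by auto
          ultimately have "\<not> x \<rightarrow>\<^bsub>G\<^esub> y" using trans[of x u y] KS[of x] KS[of y] u x y by simp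
          then show False using adjK[of x y] x y by auto
        qed
        then have "card (insert u (K - {x})) \<le> cl G u" by (intro card_le_cl extend) auto
        moreover have "card (insert u (K - {x})) = card K"
          using fin u_notin x(1) card_Suc_Diff1[OF fin x(1)] by simp
        ultimately show ?thesis using K(3) by simp
      qed
    qed
  qed
  then show ?thesis using uv by (simp add: le_antisym)
qed

text \<open>Under these hypotheses nonadjacency is an equivalence relation, and its classes are the
  parts.\<close>

lemma complete_multipartiteI:
  assumes irrefl: "\<And>u. u \<in> verts H \<Longrightarrow> \<not> u \<rightarrow>\<^bsub>H\<^esub> u"
    and sym: "\<And>u v. u \<rightarrow>\<^bsub>H\<^esub> v \<Longrightarrow> v \<rightarrow>\<^bsub>H\<^esub> u"
    and trans: "\<And>u v w. u \<in> verts H \<Longrightarrow> v \<in> verts H \<Longrightarrow> w \<in> verts H \<Longrightarrow>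
      \<not> u \<rightarrow>\<^bsub>H\<^esub> v \<Longrightarrow> \<not> v \<rightarrow>\<^bsub>H\<^esub> w \<Longrightarrow> \<not> u \<rightarrow>\<^bsub>H\<^esub> w"
  shows "complete_multipartite H"
proof -
  define R where "R = {(u, v). u \<in> verts H \<and> v \<in> verts H \<and> \<not> u \<rightarrow>\<^bsub>H\<^esub> v}"
  have R: "equiv (verts H) R"
  proof (rule equivI)
    show "R \<subseteq> verts H \<times> verts H" by (auto simp: R_def)
    show "refl_on (verts H) R" using irrefl by (auto simp: R_def refl_on_def)
    show "sym R" unfolding sym_def R_def using sym by auto
    show "trans R"
      unfolding trans_def
    proof (intro allI impI)
      fix u v w assume "(u, v) \<in> R" "(v, w) \<in> R"
      then show "(u, w) \<in> R" using trans[of u v w] by (simp add: R_def)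
    qed
  qed
  have same: "(\<exists>p\<in>verts H // R. u \<in> p \<and> v \<in> p) \<longleftrightarrow> (u, v) \<in> R"
    if "u \<in> verts H" "v \<in> verts H" for u v
  proof
    assume "\<exists>p\<in>verts H // R. u \<in> p \<and> v \<in> p"
    then obtain p where "p \<in> verts H // R" "u \<in> p" "v \<in> p" by auto
    then show "(u, v) \<in> R" using quotient_eq_iff[OF R] by metis
  next
    assume "(u, v) \<in> R"
    then show "\<exists>p\<in>verts H // R. u \<in> p \<and> v \<in> p"
      using that equiv_class_self[OF R] by (intro bexI[of _ "R `` {u}"]) (auto intro: quotientI)
  qed
  show ?thesis
    unfolding complete_multipartite_def
    using partition_on_quotient[OF R] same
    by (intro exI[of _ "verts H // R"]) (simp add: R_def)
qed

text \<open>Every inequality behind the upper bound is tight. Cauchy-Schwarz yields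
  \<open>proportional\<close>, Motzkin-Straus yields \<open>trans\<close>, and the triangle
  inequalities yield \<open>row\<close>; constancy of \<open>cl\<close> then turns
  \<open>row\<close> into a degree count.\<close>

lemma (in graph) equality_imp_regular_multipartite:
  assumes eig: "adjacency_eigenpair G W z"
    and W: "W = (\<Sum>v\<in>verts G. clique_weight G v)"
  shows "up_to_isolated_vertices (\<lambda>H. regular_graph H \<and> complete_multipartite H) G"
proof -
  let ?w = "clique_weight G" and ?A = "adj G" and ?V = "verts G"
  \<comment> \<open>These are the vertices that are not isolated.\<close>
  define S where "S = {v\<in>?V. 2 \<le> cl G v}"
  have SV: "S \<subseteq> ?V" by (auto simp: S_def)
  have S_iff: "v \<in> S \<longleftrightarrow> 0 < ?w v" if "v \<in> ?V" for v
    using clique_weight_pos_iff[OF that] cl_ge_2_iff[OF that] that by (simp add: S_def)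
  have adj_S: "u \<in> S \<and> v \<in> S" if "u \<rightarrow>\<^bsub>G\<^esub> v" for u v
    using adj_weights_pos[OF that] S_iff that by (auto simp: arcs_ends_conv)
  define a where "a = (\<lambda>v. \<bar>z v\<bar>)"
  define N where "N = (\<Sum>v\<in>?V. (a v)\<^sup>2)"
  define P where "P = (\<Sum>v\<in>?V. sqrt (?w v) * a v)"
  have N: "0 < N" using adjacency_eigenpair_norm_pos[OF eig] by (simp add: N_def a_def)
  have a0: "0 \<le> a v" for v by (simp add: a_def)
  have chain: "W * N \<le> bilin ?V ?A a a" "bilin ?V ?A a a \<le> P\<^sup>2" "P\<^sup>2 \<le> W * N"
    using adjacency_eigenpair_le_bilin[OF eig] bilin_adj_le[of a] a0 clique_weight_Cauchy_Schwarz[of a]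
    by (simp_all add: N_def P_def W a_def)
  then have P2: "P\<^sup>2 = W * N" and bilin_eq: "bilin ?V ?A a a = P\<^sup>2" by linarith+
  have W_pos: "0 < W" if "u \<in> S" for u
  proof -
    have "u \<in> ?V" "0 < ?w u" using that SV S_iff by auto
    then show ?thesis unfolding W using clique_weight_nonneg by (intro sum_pos2[of _ u]) auto
  qed
  have proportional: "W * a u = P * sqrt (?w u)" if "u \<in> ?V" for u
  proof -
    \<comment> \<open>The equality case of Cauchy-Schwarz by hand: the squared deviations from
      proportionality sum to \<open>W * (W * N - P\<^sup>2)\<close>.\<close>
    have "(\<Sum>v\<in>?V. (W * a v - P * sqrt (?w v))\<^sup>2) =
        (\<Sum>v\<in>?V. W\<^sup>2 * (a v)\<^sup>2 - 2 * W * P * (sqrt (?w v) * a v) + P\<^sup>2 * ?w v)"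
      using clique_weight_nonneg
      by (intro sum.cong refl) (simp add: power2_diff power_mult_distrib mult_ac)
    also have "\<dots> = W\<^sup>2 * N - 2 * W * P * P + P\<^sup>2 * W"
      by (simp add: sum.distrib sum_subtractf N_def W P_def sum_distrib_left)
    also have "\<dots> = W * (W * N - P\<^sup>2)" by (simp add: power2_eq_square algebra_simps)
    also have "\<dots> = 0" using P2 by simp
    finally have "(W * a u - P * sqrt (?w u))\<^sup>2 = 0"
      using that by (simp add: sum_nonneg_eq_0_iff)
    then show ?thesis by simp
  qed
  have P_pos: "0 < P" if "u \<in> S" for u
  proof -
    have "0 \<le> P" unfolding P_def using a0 clique_weight_nonneg by (intro sum_nonneg) auto
    moreover have "P\<^sup>2 > 0" using P2 W_pos[OF that] N by simp
    ultimately show ?thesis by (simp add: less_le)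
  qed
  have a_pos: "0 < a u" if "u \<in> S" for u
  proof -
    have "0 < W * a u" using proportional[of u] P_pos[OF that] S_iff[of u] that SV by auto
    then show ?thesis using W_pos[OF that] by (simp add: zero_less_mult_iff)
  qed
  have trans: "\<not> u \<rightarrow>\<^bsub>G\<^esub> x"
    if S: "u \<in> S" "v \<in> S" "x \<in> S" and non: "\<not> u \<rightarrow>\<^bsub>G\<^esub> v" "\<not> v \<rightarrow>\<^bsub>G\<^esub> x" for u v x
  proof
    assume ux: "u \<rightarrow>\<^bsub>G\<^esub> x"
    define y where "y = (\<lambda>v. sqrt (?w v) * a v)"
    have "scaled_adj G u x \<le> 0"
    proof (rule motzkin_straus_equality_trans[OF clique_weighted_scaled_adj])
      show "bilin ?V (scaled_adj G) y y = (sum y ?V)\<^sup>2"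
        using bilin_eq unfolding bilin_adj_eq_scaled by (simp add: y_def P_def)
      show "0 < y u" "0 < y v" "0 < y x"
        using S a_pos S_iff SV by (auto simp: y_def)
      show "scaled_adj G u v = 0" "scaled_adj G v x = 0"
        using non by (simp_all add: scaled_adj_def)
    qed (use S SV a0 clique_weight_nonneg in \<open>auto simp: y_def\<close>)
    moreover have "0 < scaled_adj G u x"
      using ux adj_weights_pos[OF ux] by (simp add: scaled_adj_def)
    ultimately show False by simp
  qed
  have a_const: "a u = a v" if "u \<in> S" "v \<in> S" for u v
  proof -
    have "cl G u = cl G v"
      by (rule cl_eq_of_nonadjacency_trans[OF S_def _ that]) (rule trans)
    then have "W * a u = W * a v"
      using proportional[of u] proportional[of v] that subsetD[OF SV] by (simp add: clique_weight_def)
    then show ?thesis using W_pos[OF that(1)] by simp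
  qed
  have row: "W * a u = (\<Sum>v\<in>?V. ?A u v * a v)" if "u \<in> S" for u
  proof -
    \<comment> \<open>The losses in the triangle inequality, weighted by \<open>a\<close>, are
      nonnegative and sum to 0, so each vanishes; where \<open>a\<close> is positive the row itself
      is tight.\<close>
    let ?gap = "\<lambda>u. a u * ((\<Sum>v\<in>?V. ?A u v * a v) - W * a u)"
    have "sum ?gap ?V = bilin ?V ?A a a - W * N"
      unfolding bilin_eq_sum_mult N_def
      by (simp add: sum_subtractf right_diff_distrib sum_distrib_left[of W] power2_eq_square mult_ac)
    also have "\<dots> = 0" using bilin_eq P2 by simp
    finally have "sum ?gap ?V = 0" .
    moreover have "0 \<le> ?gap v" if "v \<in> ?V" for v
      using a0 adjacency_eigenpair_abs_le[OF eig that] by (intro mult_nonneg_nonneg) (auto simp: a_def)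
    ultimately have "\<forall>v\<in>?V. ?gap v = 0" by (subst (asm) sum_nonneg_eq_0_iff) auto
    then have "?gap u = 0" using that SV by blast
    then show ?thesis using a_pos[OF that] by simp
  qed
  have degree: "real (out_degree (G \<restriction> S) u) = W" if "u \<in> S" for u
  proof -
    \<comment> \<open>The neighbours of \<open>u\<close> lie in \<open>S\<close>, where
      \<open>a\<close> is constant and positive, so \<open>a\<close> cancels from the row
      equation.\<close>
    have "W * a u = (\<Sum>v\<in>S. ?A u v * a v)"
      unfolding row[OF that] using SV adj_S by (intro sum.mono_neutral_right) auto
    also have "\<dots> = (\<Sum>v\<in>S. ?A u v) * a u"
      unfolding sum_distrib_right using a_const that by (intro sum.cong refl) metis
    finally show ?thesis
      using a_pos[OF that] out_degree_induce_subgraph[OF SV that] by simp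
  qed
  \<comment> \<open>Regularity asks for a natural number, which the floor recovers from the real
    \<open>W\<close>.\<close>
  have "out_degree (G \<restriction> S) u = nat \<lfloor>W\<rfloor>" if "u \<in> S" for u
    using degree[OF that] by (metis floor_of_nat nat_int)
  then have "regular_graph (G \<restriction> S)" by (auto simp: regular_graph_def)
  moreover have "complete_multipartite (G \<restriction> S)"
  proof (rule complete_multipartiteI)
    show "\<not> u \<rightarrow>\<^bsub>G \<restriction> S\<^esub> u" for u
      using adj_not_same[of u] by (auto simp: dominates_induce_subgraph_iff)
    show "v \<rightarrow>\<^bsub>G \<restriction> S\<^esub> u" if "u \<rightarrow>\<^bsub>G \<restriction> S\<^esub> v" for u v
      using that graph_symmetric[of u v] by (simp add: dominates_induce_subgraph_iff)
    show "\<not> u \<rightarrow>\<^bsub>G \<restriction> S\<^esub> x"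
      if "u \<in> verts (G \<restriction> S)" "v \<in> verts (G \<restriction> S)" "x \<in> verts (G \<restriction> S)"
        "\<not> u \<rightarrow>\<^bsub>G \<restriction> S\<^esub> v" "\<not> v \<rightarrow>\<^bsub>G \<restriction> S\<^esub> x" for u v x
      using that trans[of u v x] by (simp add: dominates_induce_subgraph_iff)
  qed
  moreover have "isolated G v" if "v \<in> ?V - S" for v
    using that adj_S[of v] by (auto simp: isolated_def)
  ultimately show ?thesis
    unfolding up_to_isolated_vertices_def using SV by (intro exI[of _ S]) simp
qed

section \<open>Regular complete multipartite graphs attain the bound\<close>

text \<open>By regularity each of the \<open>r\<close> parts has \<open>n - d\<close> elements, so
  \<open>n = r * (n - d)\<close>. A clique inside \<open>S\<close> has at most one vertex in each
  part, so each weight is at most \<open>1 - 1 / r\<close>, and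
  \<open>n * (1 - 1 / r) = n - (n - d) = d\<close>.\<close>

lemma sum_clique_weight_multipartite_le:
  assumes fin: "finite S" and ne: "S \<noteq> {}" and P: "partition_on S P"
    and adj: "\<And>u v. u \<in> S \<Longrightarrow> v \<in> S \<Longrightarrow> u \<rightarrow>\<^bsub>G\<^esub> v \<longleftrightarrow> \<not> (\<exists>p\<in>P. u \<in> p \<and> v \<in> p)"
    and deg: "\<And>u. u \<in> S \<Longrightarrow> (\<Sum>v\<in>S. adj G u v) = d"
    and cl: "\<And>v. v \<in> S \<Longrightarrow> 1 \<le> cl G v \<and> (\<exists>K. is_clique G K \<and> K \<subseteq> S \<and> card K = cl G v)"
  shows "(\<Sum>v\<in>S. clique_weight G v) \<le> d"
proof -
  define n where "n = real (card S)"
  define r where "r = real (card P)"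
  have P_fin: "finite P" using finite_elements[OF fin P] .
  have P_ne: "P \<noteq> {}" using P ne by (auto simp: partition_on_def)
  have r: "0 < r" using P_fin P_ne by (simp add: r_def card_gt_0_iff)
  have part_sub: "p \<subseteq> S" if "p \<in> P" for p using P that by (auto simp: partition_on_def)
  have part_uniq: "p = q" if "p \<in> P" "q \<in> P" "u \<in> p" "u \<in> q" for p q u
    using partition_onD2[OF P] that by (auto simp: disjoint_def)
  have card_part: "real (card p) = n - d" if p: "p \<in> P" for p
  proof -
    have "p \<noteq> {}" using P p by (auto simp: partition_on_def)
    then obtain u where u: "u \<in> p" by auto
    then have uS: "u \<in> S" using part_sub[OF p] by auto
    \<comment> \<open>The part of \<open>u\<close> consists of the nonneighbours of \<open>u\<close>
      in \<open>S\<close>, including \<open>u\<close> itself, so the degree determines its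
      size.\<close>
    have "p = {v\<in>S. \<not> u \<rightarrow>\<^bsub>G\<^esub> v}"
    proof (intro equalityI subsetI)
      fix v assume "v \<in> p"
      then show "v \<in> {v\<in>S. \<not> u \<rightarrow>\<^bsub>G\<^esub> v}" using adj[OF uS, of v] part_sub[OF p] p u by auto
    next
      fix v assume "v \<in> {v\<in>S. \<not> u \<rightarrow>\<^bsub>G\<^esub> v}"
      then have "v \<in> S" "\<not> u \<rightarrow>\<^bsub>G\<^esub> v" by auto
      then obtain q where "q \<in> P" "u \<in> q" "v \<in> q" using adj[OF uS, of v] by auto
      then show "v \<in> p" using part_uniq[of q p u] p u by simp
    qed
    then have "real (card p) = (\<Sum>v\<in>S. of_bool (\<not> u \<rightarrow>\<^bsub>G\<^esub> v))"
      using fin by (simp add: of_bool_def sum.If_cases Int_def)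
    also have "\<dots> = (\<Sum>v\<in>S. 1 - adj G u v)" by (intro sum.cong refl) auto
    also have "\<dots> = n - d" using deg[OF uS] by (simp add: sum_subtractf n_def)
    finally show ?thesis .
  qed
  have "finite p" if "p \<in> P" for p using part_sub[OF that] fin by (rule finite_subset)
  then have "card (\<Union>P) = (\<Sum>p\<in>P. card p)"
    by (rule card_Union_disjoint[OF partition_onD2[OF P]])
  then have "n = (\<Sum>p\<in>P. real (card p))"
    unfolding n_def partition_onD1[OF P] by simp
  also have "\<dots> = (\<Sum>p\<in>P. n - d)" by (intro sum.cong refl card_part)
  also have "\<dots> = r * (n - d)" by (simp add: r_def)
  finally have n: "n = r * (n - d)" .
  have "clique_weight G v \<le> 1 - 1 / r" if v: "v \<in> S" for v
  proof -
    obtain K where K: "is_clique G K" "K \<subseteq> S" "card K = cl G v" using cl[OF v] by auto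
    have "\<forall>x\<in>K. \<exists>p. p \<in> P \<and> x \<in> p" using K(2) partition_onD1[OF P] by auto
    then obtain f where f: "\<forall>x\<in>K. f x \<in> P \<and> x \<in> f x" by (rule bchoice[THEN exE])
    \<comment> \<open>Two vertices in the same part are nonadjacent, so distinct clique vertices lie
      in distinct parts.\<close>
    have "inj_on f K"
    proof (rule inj_onI)
      fix x y assume xy: "x \<in> K" "y \<in> K" "f x = f y"
      then have "f x \<in> P" "x \<in> f x" "y \<in> f x" using f by auto
      then have "\<not> x \<rightarrow>\<^bsub>G\<^esub> y" using adj[of x y] xy K(2) by auto
      then show "x = y" using K(1) xy by (auto simp: is_clique_def)
    qed
    then have "card K \<le> card P" using f by (intro card_inj_on_le[OF _ _ P_fin]) auto
    then have "real (cl G v) \<le> r" by (simp add: K(3) r_def)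
    moreover have "1 \<le> cl G v" using cl[OF v] by simp
    ultimately have "1 / r \<le> 1 / real (cl G v)" by (intro frac_le) auto
    then show ?thesis using \<open>1 \<le> cl G v\<close> by (simp add: clique_weight_def diff_divide_distrib)
  qed
  then have "(\<Sum>v\<in>S. clique_weight G v) \<le> n * (1 - 1 / r)"
    using sum_bounded_above[of S "clique_weight G" "1 - 1 / r"] by (simp add: n_def)
  also have "\<dots> = n - n / r" by (simp add: algebra_simps)
  also have "n / r = n - d" using n r by (simp add: divide_eq_eq mult.commute)
  finally show ?thesis by simp
qed

text \<open>All edges lie inside \<open>S\<close>, so the indicator of \<open>S\<close> is an
  eigenfunction for the common degree \<open>d\<close> unless \<open>S\<close> is empty. Thus
  \<open>d\<close> is at most the spectral radius, while the weights outside \<open>S\<close> vanish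
  and those inside sum to at most \<open>d\<close>.\<close>

lemma (in graph) regular_multipartite_imp_weight_le:
  assumes ne: "verts G \<noteq> {}"
    and "up_to_isolated_vertices (\<lambda>H. regular_graph H \<and> complete_multipartite H) G"
  shows "(\<Sum>v\<in>verts G. clique_weight G v) \<le> graph_spectral_radius G"
proof -
  let ?V = "verts G"
  obtain S where SV: "S \<subseteq> ?V" and iso: "\<And>v. v \<in> ?V - S \<Longrightarrow> isolated G v"
    and reg: "regular_graph (G \<restriction> S)" and mult: "complete_multipartite (G \<restriction> S)"
    using assms(2) unfolding up_to_isolated_vertices_def by auto
  have fin: "finite S" using SV by (rule finite_subset) simp
  have in_S: "u \<in> S \<and> v \<in> S" if uv: "u \<rightarrow>\<^bsub>G\<^esub> v" for u v
  proof -
    have "x \<in> S" if xy: "x \<rightarrow>\<^bsub>G\<^esub> y" for x y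
    proof -
      have "x \<in> ?V" "y \<in> ?V" using xy by (auto simp: arcs_ends_conv)
      then show ?thesis using xy iso[of x] by (auto simp: isolated_def)
    qed
    then show ?thesis using uv graph_symmetric[OF uv] by metis
  qed
  have "clique_weight G v = 0" if v: "v \<in> ?V - S" for v
  proof -
    have "\<not> 0 < clique_weight G v" using clique_weight_pos_iff[of v] in_S[of v] v by auto
    then show ?thesis using clique_weight_nonneg[of v] v by simp
  qed
  then have W: "(\<Sum>v\<in>?V. clique_weight G v) = (\<Sum>v\<in>S. clique_weight G v)"
    using SV by (intro sum.mono_neutral_right) auto
  show ?thesis
  proof (cases "S = {}")
    case True
    \<comment> \<open>The graph has no edges, so every function is annihilated and the constant 1 is
      an eigenfunction for 0.\<close>
    then have "adjacency_eigenpair G 0 (\<lambda>_. 1)"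
      using ne in_S by (auto simp: adjacency_eigenpair_def)
    then have "0 \<le> graph_spectral_radius G" by (rule graph_spectral_radius_eigen(2)[OF ne])
    then show ?thesis using W True by simp
  next
    case False
    obtain d where "\<And>u. u \<in> S \<Longrightarrow> out_degree (G \<restriction> S) u = d"
      using reg by (auto simp: regular_graph_def)
    then have deg: "(\<Sum>v\<in>S. adj G u v) = real d" if "u \<in> S" for u
      using out_degree_induce_subgraph[OF SV that] that by simp
    obtain P where P: "partition_on S P"
      and adj: "\<And>u v. u \<in> S \<Longrightarrow> v \<in> S \<Longrightarrow> u \<rightarrow>\<^bsub>G\<^esub> v \<longleftrightarrow> \<not> (\<exists>p\<in>P. u \<in> p \<and> v \<in> p)"
      using mult by (auto simp: complete_multipartite_def dominates_induce_subgraph_iff)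
    have "adjacency_eigenpair G (real d) (\<lambda>v. of_bool (v \<in> S))"
      unfolding adjacency_eigenpair_def
    proof (intro conjI ballI)
      show "\<exists>v\<in>?V. of_bool (v \<in> S) \<noteq> (0::real)" using False SV by auto
      fix u assume "u \<in> ?V"
      have "(\<Sum>v\<in>?V. adj G u v * of_bool (v \<in> S)) = (\<Sum>v\<in>S. adj G u v)"
        using SV by (intro sum.mono_neutral_cong_right) auto
      also have "\<dots> = real d * of_bool (u \<in> S)"
      proof (cases "u \<in> S")
        case False
        then have "adj G u v = 0" for v using in_S[of u v] by auto
        then show ?thesis using False by (simp only: sum.neutral_const) simp
      qed (use deg in simp)
      finally show "(\<Sum>v\<in>?V. adj G u v * of_bool (v \<in> S)) = real d * of_bool (u \<in> S)" .
    qed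
    then have "real d \<le> graph_spectral_radius G" by (rule graph_spectral_radius_eigen(2)[OF ne])
    moreover have "(\<Sum>v\<in>S. clique_weight G v) \<le> real d"
    proof (rule sum_clique_weight_multipartite_le[OF fin False P adj deg])
      fix v assume v: "v \<in> S"
      then have vV: "v \<in> ?V" using SV by auto
      obtain K where K: "is_clique G K" "v \<in> K" "card K = cl G v" using cl_attained[OF vV] .
      \<comment> \<open>Every other member of \<open>K\<close> is adjacent to \<open>v\<close>, and
        edges do not leave \<open>S\<close>.\<close>
      have "K \<subseteq> S"
      proof
        fix x assume "x \<in> K"
        then show "x \<in> S" using K v in_S[of v x] by (cases "x = v") (auto simp: is_clique_def)
      qed
      then show "1 \<le> cl G v \<and> (\<exists>K. is_clique G K \<and> K \<subseteq> S \<and> card K = cl G v)"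
        using K cl_pos[OF vV] by (intro conjI exI[of _ K]) auto
    qed
    ultimately show ?thesis using W by simp
  qed
qed

theorem theorem1p8:
  fixes G :: "('a, 'b) pre_digraph"
  assumes "graph G" and "verts G \<noteq> {}"
  shows "graph_spectral_radius G \<le> (\<Sum>v\<in>verts G. (real (cl G v) - 1) / real (cl G v)) \<and>
    (graph_spectral_radius G = (\<Sum>v\<in>verts G. (real (cl G v) - 1) / real (cl G v)) \<longleftrightarrow>
      up_to_isolated_vertices (\<lambda>H. regular_graph H \<and> complete_multipartite H) G)"
proof -
  interpret graph G by fact
  obtain z where z: "adjacency_eigenpair G (graph_spectral_radius G) z"
    using graph_spectral_radius_eigen(1)[OF assms(2)] by auto
  have le: "graph_spectral_radius G \<le> (\<Sum>v\<in>verts G. clique_weight G v)"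
    by (rule adjacency_eigenpair_le_weight[OF z])
  \<comment> \<open>Equality makes \<open>z\<close> an eigenfunction for the weight sum itself,
    which gives the structure; conversely the structure gives the reverse of
    \<open>le\<close>.\<close>
  show ?thesis
    unfolding clique_weight_def[symmetric]
    using le equality_imp_regular_multipartite[OF z]
      regular_multipartite_imp_weight_le[OF assms(2)] by (auto intro: antisym)
qed

end
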